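(* Let $G$ be a countable sofic group, $\Sigma$ a sofic approximation sequence for $G$, and $\pi:(X,G)\to(Y,G)$ a factor map between $G$-systems. Then $\mathrm{mdim}_\Sigma(X|\pi)>0$ if and only if $\mathrm D_n^{\mathrm{md}}(X|\pi,G,\Sigma)\neq\emptyset$ for some $n\ge2$.
   Context: For $d\in\mathbb N$ write $[d]=\{1,\dots,d\}$ and $\mathrm{Sym}(d)$ for the permutation group of $[d]$. A sofic approximation sequence for a countable group $G$ is a sequence of maps (not necessarily homomorphisms) $\Sigma=\{\sigma_i:G\to\mathrm{Sym}(d_i)\}_{i\ge1}$ such that $\frac1{d_i}|\{v\in[d_i]:\sigma_i(s)\sigma_i(t)(v)=\sigma_i(st)(v)\}|\to1$ for all $s,t\in G$, $\frac1{d_i}|\{v\in[d_i]:\sigma_i(s)(v)=\sigma_i(t)(v)\}|\to0$ for all distinct $s,t\in G$, and $d_i\to\infty$; $G$ is sofic if one exists. A $G$-system $(X,G)$ is a compact metric space $X$ with a continuous action of $G$ by homeomorphisms. A factor map $\pi:(X,G)\to(Y,G)$ is a continuous surjection with $\pi(gx)=g\pi(x)$. $\mathcal F(G)$ is the collection of nonempty finite subsets of $G$. For a compatible metric $\rho$ on $X$, $F\in\mathcal F(G)$, $\delta>0$ and a map $\sigma:G\to\mathrm{Sym}(d)$, $\mathrm{Map}(\rho,F,\delta,\sigma)\subset X^d$ is the set of maps $\xi:[d]\to X$ with $\big(\frac1d\sum_{a\in[d]}\rho(\xi(\sigma(s)(a)),s\,\xi(a))^2\big)^{1/2}\le\delta$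 for all $s\in F$. Let $\pi^d:X^d\to Y^d$, $\xi\mapsto\pi\circ\xi$. For a finite open cover $\beta$ of a space $K$, $\mathrm{ord}(\beta)=\max_{x\in K}\sum_{U\in\beta}1_U(x)-1$ (and $-\infty$ if $K=\emptyset$). A family of sets refines a cover $\alpha$ if each of its members is contained in a member of $\alpha$; the join $\vee$ of two families consists of pairwise intersections. For a finite open cover $\alpha$ of $X$, $\alpha^d$ is the cover of $X^d$ by the sets $U_1\times\cdots\times U_d$ with $U_j\in\alpha$. With $M=\mathrm{Map}(\rho,F,\delta,\sigma)$, let $D(\alpha|\pi,\rho,F,\delta,\sigma)$ be the minimum of $\mathrm{ord}(\beta)$ over all finite open covers $\beta$ of $M$ such that $\{(\pi^d|_M)^{-1}(y)\}_{y\in\pi^d(M)}\vee\beta$ refines $\alpha^d|_M$. Let $$\mathrm{mdim}_\Sigma(\alpha|\pi)=\inf_{F\in\mathcal F(G)}\inf_{\delta>0}\limsup_{i\to\infty}\frac{D(\alpha|\pi,\rho,F,\delta,\sigma_i)}{d_i},\qquad \mathrm{mdim}_\Sigma(X|\pi)=\sup_\alpha\mathrm{mdim}_\Sigma(\alpha|\pi),$$ the supremum over finite open covers $\alpha$ of $X$; the limsup is $-\infty$ if $\mathrm{Map}(\rho,F,\delta,\sigma_i)=\emptyset$ for all large $i$. These values do not depend on the compatible metric $\rho$. Let $\Delta_n(X)=\{(x,\dots,x):x\in X\}\subset X^n$. For $(x_i)_{i=1}^n\in X^n\setminus\Delta_n(X)$, a finite open cover $\alpha$ of $X$ is admissible with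 respect to $(x_i)_{i=1}^n$ if $\{x_1,\dots,x_n\}\not\subset\overline U$ for every $U\in\alpha$. For $n\ge2$, $\mathrm D_n^{\mathrm{md}}(X|\pi,G,\Sigma)$ is the set of sofic conditional mean dimension $n$-tuples, i.e. of $(x_i)_{i=1}^n\in X^n\setminus\Delta_n(X)$ such that $\mathrm{mdim}_\Sigma(\alpha|\pi)>0$ for every admissible open cover $\alpha$ with respect to $(x_i)_{i=1}^n$. *)

theory Defs
  imports "HOL-Analysis.Analysis" "HOL-Algebra.Group_Action" "HOL-Algebra.Sym_Groups"
begin

text \<open>
  The set \<open>[d]\<close> is \<open>{1..d}\<close> and \<open>Sym(d)\<close> is \<^term>\<open>sym_group d\<close>.  Sequences are indexed by all
  of \<^typ>\<open>nat\<close>, starting at 0 instead of 1.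
\<close>

definition sofic_approximation ::
    "('g, 'm) monoid_scheme \<Rightarrow> (nat \<Rightarrow> nat) \<Rightarrow> (nat \<Rightarrow> 'g \<Rightarrow> nat \<Rightarrow> nat) \<Rightarrow> bool" where
  "sofic_approximation G d \<sigma> \<longleftrightarrow>
     (\<forall>i. d i > 0) \<and>
     (\<forall>i. \<sigma> i \<in> carrier G \<rightarrow> carrier (sym_group (d i))) \<and>
     (\<forall>s\<in>carrier G. \<forall>t\<in>carrier G.
        (\<lambda>i. real (card {v \<in> {1..d i}. \<sigma> i s (\<sigma> i t v) = \<sigma> i (s \<otimes>\<^bsub>G\<^esub> t) v}) / real (d i))
          \<longlonglongrightarrow> 1) \<and>
     (\<forall>s\<in>carrier G. \<forall>t\<in>carrier G. s \<noteq> t \<longrightarrow>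
        (\<lambda>i. real (card {v \<in> {1..d i}. \<sigma> i s v = \<sigma> i t v}) / real (d i)) \<longlonglongrightarrow> 0) \<and>
     filterlim d at_top sequentially"

definition sofic_group :: "('g, 'm) monoid_scheme \<Rightarrow> bool" where
  "sofic_group G \<longleftrightarrow> group G \<and> (\<exists>d \<sigma>. sofic_approximation G d \<sigma>)"

text \<open>
  A system is carried by a compact metrizable topology; the metric itself enters only through
  \<open>compatible_metric\<close> below.
\<close>

definition G_system :: "('g, 'm) monoid_scheme \<Rightarrow> 'a topology \<Rightarrow> ('g \<Rightarrow> 'a \<Rightarrow> 'a) \<Rightarrow> bool" where
  "G_system G X \<phi> \<longleftrightarrow>
     compact_space X \<and> metrizable_space X \<and>
     group_action G (topspace X) \<phi> \<and>
     (\<forall>g\<in>carrier G. homeomorphic_map X X (\<phi> g))"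

definition factor_map ::
    "('g, 'm) monoid_scheme \<Rightarrow> 'a topology \<Rightarrow> ('g \<Rightarrow> 'a \<Rightarrow> 'a) \<Rightarrow>
     'b topology \<Rightarrow> ('g \<Rightarrow> 'b \<Rightarrow> 'b) \<Rightarrow> ('a \<Rightarrow> 'b) \<Rightarrow> bool" where
  "factor_map G X \<phi> Y \<psi> \<pi> \<longleftrightarrow>
     continuous_map X Y \<pi> \<and> \<pi> ` topspace X = topspace Y \<and>
     (\<forall>g\<in>carrier G. \<forall>x\<in>topspace X. \<pi> (\<phi> g x) = \<psi> g (\<pi> x))"

definition compatible_metric :: "'a topology \<Rightarrow> ('a \<Rightarrow> 'a \<Rightarrow> real) \<Rightarrow> bool" where
  "compatible_metric X \<rho> \<longleftrightarrow>
     Metric_space (topspace X) \<rho> \<and> Metric_space.mtopology (topspace X) \<rho> = X"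

definition finite_open_cover :: "'a topology \<Rightarrow> 'a set set \<Rightarrow> bool" where
  "finite_open_cover T \<beta> \<longleftrightarrow> finite \<beta> \<and> (\<forall>U\<in>\<beta>. openin T U) \<and> \<Union>\<beta> = topspace T"

definition cover_ord :: "'a set \<Rightarrow> 'a set set \<Rightarrow> ereal" where
  "cover_ord K \<beta> =
     (if K = {} then -\<infinity>
      else ereal (Max ((\<lambda>x. \<Sum>U\<in>\<beta>. indicator U x) ` K) - 1))"

definition refines_family :: "'a set set \<Rightarrow> 'a set set \<Rightarrow> bool" where
  "refines_family \<A> \<B> \<longleftrightarrow> (\<forall>A\<in>\<A>. \<exists>B\<in>\<B>. A \<subseteq> B)"

definition join_family :: "'a set set \<Rightarrow> 'a set set \<Rightarrow> 'a set set" where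
  "join_family \<A> \<B> = {A \<inter> B | A B. A \<in> \<A> \<and> B \<in> \<B>}"

definition restrict_family :: "'a set set \<Rightarrow> 'a set \<Rightarrow> 'a set set" where
  "restrict_family \<A> M = {A \<inter> M | A. A \<in> \<A>}"

definition power_cover :: "nat \<Rightarrow> 'a set set \<Rightarrow> (nat \<Rightarrow> 'a) set set" where
  "power_cover d \<alpha> = {Pi\<^sub>E {1..d} U | U. U \<in> {1..d} \<rightarrow> \<alpha>}"

definition sofic_Map ::
    "'a topology \<Rightarrow> ('g \<Rightarrow> 'a \<Rightarrow> 'a) \<Rightarrow> ('a \<Rightarrow> 'a \<Rightarrow> real) \<Rightarrow> 'g set \<Rightarrow> real \<Rightarrow>
     nat \<Rightarrow> ('g \<Rightarrow> nat \<Rightarrow> nat) \<Rightarrow> (nat \<Rightarrow> 'a) set" where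
  "sofic_Map X \<phi> \<rho> F \<delta> d \<tau> =
     {\<xi> \<in> {1..d} \<rightarrow>\<^sub>E topspace X.
        \<forall>s\<in>F. sqrt (1 / real d * (\<Sum>a\<in>{1..d}. (\<rho> (\<xi> (\<tau> s a)) (\<phi> s (\<xi> a)))\<^sup>2)) \<le> \<delta>}"

definition power_map :: "nat \<Rightarrow> ('a \<Rightarrow> 'b) \<Rightarrow> (nat \<Rightarrow> 'a) \<Rightarrow> nat \<Rightarrow> 'b" where
  "power_map d \<pi> \<xi> = (\<lambda>a\<in>{1..d}. \<pi> (\<xi> a))"

definition fibre_family :: "('c \<Rightarrow> 'b) \<Rightarrow> 'c set \<Rightarrow> 'c set set" where
  "fibre_family f M = {{\<xi> \<in> M. f \<xi> = y} | y. y \<in> f ` M}"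

text \<open>
  The infimum below is a minimum: the orders lie in \<open>{-\<infinity>} \<union> {0, 1, 2, \<dots>}\<close>, and the cover
  \<open>\<alpha>\<^sup>d|\<^sub>M\<close> itself is a competitor.
\<close>

definition D_cond ::
    "'a topology \<Rightarrow> ('g \<Rightarrow> 'a \<Rightarrow> 'a) \<Rightarrow> 'a set set \<Rightarrow> ('a \<Rightarrow> 'b) \<Rightarrow> ('a \<Rightarrow> 'a \<Rightarrow> real) \<Rightarrow>
     'g set \<Rightarrow> real \<Rightarrow> nat \<Rightarrow> ('g \<Rightarrow> nat \<Rightarrow> nat) \<Rightarrow> ereal" where
  "D_cond X \<phi> \<alpha> \<pi> \<rho> F \<delta> d \<tau> =
     (let M = sofic_Map X \<phi> \<rho> F \<delta> d \<tau> in
      INF \<beta> \<in> {\<beta>. finite_open_cover (subtopology (product_topology (\<lambda>_. X) {1..d}) M) \<beta> \<and>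
                   refines_family (join_family (fibre_family (power_map d \<pi>) M) \<beta>)
                                  (restrict_family (power_cover d \<alpha>) M)}.
        cover_ord M \<beta>)"

definition mdim_cover ::
    "('g, 'm) monoid_scheme \<Rightarrow> (nat \<Rightarrow> nat) \<Rightarrow> (nat \<Rightarrow> 'g \<Rightarrow> nat \<Rightarrow> nat) \<Rightarrow>
     'a topology \<Rightarrow> ('g \<Rightarrow> 'a \<Rightarrow> 'a) \<Rightarrow> ('a \<Rightarrow> 'a \<Rightarrow> real) \<Rightarrow> ('a \<Rightarrow> 'b) \<Rightarrow> 'a set set \<Rightarrow> ereal" where
  "mdim_cover G d \<sigma> X \<phi> \<rho> \<pi> \<alpha> =
     (INF F \<in> {F. finite F \<and> F \<noteq> {} \<and> F \<subseteq> carrier G}.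
      INF \<delta> \<in> {0<..}.
        limsup (\<lambda>i. D_cond X \<phi> \<alpha> \<pi> \<rho> F \<delta> (d i) (\<sigma> i) / ereal (real (d i))))"

definition mdim ::
    "('g, 'm) monoid_scheme \<Rightarrow> (nat \<Rightarrow> nat) \<Rightarrow> (nat \<Rightarrow> 'g \<Rightarrow> nat \<Rightarrow> nat) \<Rightarrow>
     'a topology \<Rightarrow> ('g \<Rightarrow> 'a \<Rightarrow> 'a) \<Rightarrow> ('a \<Rightarrow> 'a \<Rightarrow> real) \<Rightarrow> ('a \<Rightarrow> 'b) \<Rightarrow> ereal" where
  "mdim G d \<sigma> X \<phi> \<rho> \<pi> =
     (SUP \<alpha> \<in> {\<alpha>. finite_open_cover X \<alpha>}. mdim_cover G d \<sigma> X \<phi> \<rho> \<pi> \<alpha>)"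

definition diagonal :: "nat \<Rightarrow> 'a set \<Rightarrow> (nat \<Rightarrow> 'a) set" where
  "diagonal n S = {(\<lambda>i\<in>{1..n}. a) | a. a \<in> S}"

definition admissible_cover :: "'a topology \<Rightarrow> nat \<Rightarrow> (nat \<Rightarrow> 'a) \<Rightarrow> 'a set set \<Rightarrow> bool" where
  "admissible_cover X n x \<alpha> \<longleftrightarrow>
     finite_open_cover X \<alpha> \<and> (\<forall>U\<in>\<alpha>. \<not> x ` {1..n} \<subseteq> X closure_of U)"

definition mdim_tuples ::
    "nat \<Rightarrow> ('g, 'm) monoid_scheme \<Rightarrow> (nat \<Rightarrow> nat) \<Rightarrow> (nat \<Rightarrow> 'g \<Rightarrow> nat \<Rightarrow> nat) \<Rightarrow>
     'a topology \<Rightarrow> ('g \<Rightarrow> 'a \<Rightarrow> 'a) \<Rightarrow> ('a \<Rightarrow> 'a \<Rightarrow> real) \<Rightarrow> ('a \<Rightarrow> 'b) \<Rightarrow> (nat \<Rightarrow> 'a) set" where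
  "mdim_tuples n G d \<sigma> X \<phi> \<rho> \<pi> =
     {x \<in> ({1..n} \<rightarrow>\<^sub>E topspace X) - diagonal n (topspace X).
        \<forall>\<alpha>. admissible_cover X n x \<alpha> \<longrightarrow> mdim_cover G d \<sigma> X \<phi> \<rho> \<pi> \<alpha> > 0}"

end

theory Submission
  imports Defs
begin

text \<open>
  One direction is soft.  A tuple in \<open>D_n\<close> has two distinct entries \<open>p\<close>, \<open>q\<close>, and regularity
  gives a cover of \<open>X\<close> by two open sets, the closure of the first missing \<open>q\<close> and that of the
  second missing \<open>p\<close> (\<open>separating_admissible_cover\<close>).  This cover is admissible, so it has
  positive mean dimension, and the supremum over all covers is positive.

  For the converse let \<open>\<alpha> = {e 1, \<dots>, e n}\<close> be a cover with \<open>mdim(\<alpha>|\<pi>) > 0\<close>.  The tuple is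
  sought in the compact set \<open>K = (X - e 1) \<times> \<dots> \<times> (X - e n)\<close>, which contains no constant tuple
  because \<open>\<alpha>\<close> covers \<open>X\<close>.  If no \<open>x\<close> in \<open>K\<close> is a mean dimension tuple, each of them has an
  admissible cover \<open>\<beta>\<^sub>x\<close> with \<open>mdim(\<beta>\<^sub>x|\<pi>) \<le> 0\<close>.  Admissibility is an open condition: there is
  a box around \<open>x\<close> such that every member of \<open>\<beta>\<^sub>x\<close> misses one of the sides of the box.  Finitely
  many boxes, around the points of a finite \<open>J \<subseteq> K\<close>, cover \<open>K\<close>, and then the join of the \<open>\<beta>\<^sub>x\<close>,
  \<open>x \<in> J\<close>, refines \<open>\<alpha>\<close>: a member of the join that lies in no \<open>e i\<close> would contain points
  \<open>y i \<notin> e i\<close>, and the tuple \<open>y \<in> K\<close> would lie in no box (\<open>admissible_join_of_local_covers\<close>).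
  Subadditivity of the mean dimension under joins (\<open>mdim_cover_join_nonpos\<close>) now yields
  \<open>mdim(\<alpha>|\<pi>) \<le> 0\<close>, a contradiction.

  Subadditivity rests on a fact of dimension theory (\<open>join_covers_order\<close>): finitely many finite
  open covers of a metrizable space have a common finite open refinement whose order is at most
  the sum of their orders.  It is applied to covers of the sets of approximate orbits
  \<open>Map(\<rho>,F,\<delta>,\<sigma>)\<close>.  A common refinement inherits the fibrewise condition of the definition of
  \<open>D\<close> (\<open>fibrewise_refining_join\<close>), hence \<open>D\<close> is subadditive for each \<open>F\<close>, \<open>\<delta>\<close>, \<open>\<sigma>\<close>, and
  monotonicity of \<open>D\<close> in \<open>F\<close> and \<open>\<delta>\<close> carries this over to the infimum.
\<close>

section \<open>Refining finitely many covers with additive order\<close>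

text \<open>
  The distance to the complement is such a function.
\<close>

lemma metrizable_open_cozero:
  assumes "metrizable_space T" and "openin T U"
  obtains f where "continuous_map T euclideanreal f" and "\<And>x. 0 \<le> f x"
    and "\<And>x. x \<in> topspace T \<Longrightarrow> 0 < f x \<longleftrightarrow> x \<in> U"
proof (cases "U = topspace T")
  case True
  \<comment> \<open>The complement is empty here, so that there is no distance to take.\<close>
  then show ?thesis by (intro that[of "\<lambda>_. 1"]) auto
next
  case False
  obtain M r where "Metric_space M r" and T: "T = Metric_space.mtopology M r"
    using assms(1) metrizable_space_def by blast
  interpret Metric_space M r by fact
  define C where "C = M - U"
  have C: "C \<noteq> {}" "C \<subseteq> M"
    using False openin_subset[OF assms(2)] by (auto simp: C_def T)
  define f where "f x = (INF c\<in>C. r x c)" for x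
  have bdd: "bdd_below (r x ` C)" for x
    by (rule bdd_belowI2[of _ 0]) simp
  have f_nonneg: "0 \<le> f x" for x
    unfolding f_def using C by (intro cINF_greatest) auto
  have f_lip: "f x \<le> f a + r a x" if "x \<in> M" "a \<in> M" for x a
  proof -
    have "f x - r a x \<le> r a c" if "c \<in> C" for c
    proof -
      have "f x \<le> r x c" unfolding f_def by (intro cINF_lower bdd that)
      also have "\<dots> \<le> r a x + r a c"
        using triangle[of x a c] C \<open>x \<in> M\<close> \<open>a \<in> M\<close> that by (auto simp: commute)
      finally show ?thesis by simp
    qed
    then have "f x - r a x \<le> f a"
      unfolding f_def[of a] using C by (intro cINF_greatest) auto
    then show ?thesis by simp
  qed
  have "continuous_map T euclideanreal f"
    unfolding T continuous_map_from_metric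
  proof (intro conjI ballI allI impI)
    fix a V assume a: "a \<in> M" and V: "openin euclideanreal V \<and> f a \<in> V"
    then obtain e where e: "e > 0" "\<And>y. dist y (f a) < e \<Longrightarrow> y \<in> V"
      using open_dist[of V] by auto
    have "f x \<in> V" if "x \<in> M \<and> r a x < e" for x
      using f_lip[of x a] f_lip[of a x] that a
      by (intro e(2)) (auto simp: dist_real_def abs_less_iff commute)
    with e(1) show "\<exists>q>0. \<forall>x. x \<in> M \<and> r a x < q \<longrightarrow> f x \<in> V" by blast
  qed auto
  moreover have "0 < f x \<longleftrightarrow> x \<in> U" if x: "x \<in> topspace T" for x
  proof
    assume "0 < f x"
    show "x \<in> U"
    proof (rule ccontr)
      assume "x \<notin> U"
      with x have "x \<in> C" by (simp add: C_def T)
      then have "f x \<le> r x x" unfolding f_def by (intro cINF_lower bdd)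
      with \<open>0 < f x\<close> x show False by (simp add: T)
    qed
  next
    assume "x \<in> U"
    then obtain e where e: "e > 0" "mball x e \<subseteq> U"
      using assms(2) unfolding T openin_mtopology by blast
    have "e \<le> f x"
      unfolding f_def
    proof (intro cINF_greatest C)
      fix c assume "c \<in> C"
      then have "c \<notin> mball x e" using e by (auto simp: C_def)
      with \<open>c \<in> C\<close> C x show "e \<le> r x c" by (auto simp: T)
    qed
    with e show "0 < f x" by simp
  qed
  ultimately show ?thesis using that f_nonneg by blast
qed

lemma metrizable_partition_of_unity:
  assumes T: "metrizable_space T" and cov: "finite_open_cover T \<beta>"
  obtains f where "\<And>U. U \<in> \<beta> \<Longrightarrow> continuous_map T euclideanreal (f U)"
    and "\<And>U x. U \<in> \<beta> \<Longrightarrow> x \<in> topspace T \<Longrightarrow> 0 \<le> f U x"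
    and "\<And>U x. U \<in> \<beta> \<Longrightarrow> x \<in> topspace T \<Longrightarrow> 0 < f U x \<longleftrightarrow> x \<in> U"
    and "\<And>x. x \<in> topspace T \<Longrightarrow> (\<Sum>U\<in>\<beta>. f U x) = 1"
proof -
  have fin: "finite \<beta>" and un: "\<Union>\<beta> = topspace T"
    using cov by (auto simp: finite_open_cover_def)
  have "\<forall>U\<in>\<beta>. \<exists>h. continuous_map T euclideanreal h \<and> (\<forall>x. 0 \<le> h x) \<and>
      (\<forall>x\<in>topspace T. 0 < h x \<longleftrightarrow> x \<in> U)"
  proof
    fix U assume "U \<in> \<beta>"
    then have "openin T U" using cov by (auto simp: finite_open_cover_def)
    from metrizable_open_cozero[OF T this] show "\<exists>h. continuous_map T euclideanreal h \<and>
      (\<forall>x. 0 \<le> h x) \<and> (\<forall>x\<in>topspace T. 0 < h x \<longleftrightarrow> x \<in> U)" by metis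
  qed
  from bchoice[OF this] obtain h where "\<forall>U\<in>\<beta>. continuous_map T euclideanreal (h U) \<and>
      (\<forall>x. 0 \<le> h U x) \<and> (\<forall>x\<in>topspace T. 0 < h U x \<longleftrightarrow> x \<in> U)" ..
  then have h: "\<And>U. U \<in> \<beta> \<Longrightarrow> continuous_map T euclideanreal (h U)"
      "\<And>U x. U \<in> \<beta> \<Longrightarrow> 0 \<le> h U x"
      "\<And>U x. U \<in> \<beta> \<Longrightarrow> x \<in> topspace T \<Longrightarrow> 0 < h U x \<longleftrightarrow> x \<in> U"
    by blast+
  define s where "s x = (\<Sum>U\<in>\<beta>. h U x)" for x
  have s_pos: "0 < s x" if x: "x \<in> topspace T" for x
  proof -
    obtain U where "U \<in> \<beta>" "x \<in> U" using x unfolding un[symmetric] by blast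
    then show ?thesis
      unfolding s_def using h fin x by (intro sum_pos2[of _ U]) auto
  qed
  have s_cont: "continuous_map T euclideanreal s"
    unfolding s_def using h(1) fin by (intro continuous_map_sum) auto
  show ?thesis
  proof (rule that[of "\<lambda>U x. h U x / s x"])
    show "continuous_map T euclideanreal (\<lambda>x. h U x / s x)" if "U \<in> \<beta>" for U
      using h(1)[OF that] s_cont s_pos by (intro continuous_map_real_divide) (auto simp: less_le)
    show "0 \<le> h U x / s x" if "U \<in> \<beta>" "x \<in> topspace T" for U x
      using h(2)[OF that(1), of x] s_pos[OF that(2)] by simp
    show "0 < h U x / s x \<longleftrightarrow> x \<in> U" if "U \<in> \<beta>" "x \<in> topspace T" for U x
      using h(3)[OF that] s_pos[OF that(2)] by (simp add: zero_less_divide_iff)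
    show "(\<Sum>U\<in>\<beta>. h U x / s x) = 1" if "x \<in> topspace T" for x
      using s_pos[OF that] by (simp add: s_def flip: sum_divide_distrib)
  qed
qed

text \<open>
  This is Ostrand's colouring argument.  Put \<open>N = 1 + \<Sum>j\<in>J. m j\<close> and use \<open>N\<close> colours, the colour
  \<open>k\<close> being a threshold \<open>t k > 0\<close>.  For each colour, group the points of the space by which
  functions of the partitions of unity are above and which are below the threshold.  Two different
  groups of one colour are disjoint, so a point lies in at most \<open>N\<close> groups altogether.  A point is
  in no group of colour \<open>k\<close> only if one of the functions takes the value \<open>t k\<close> there.  For each \<open>j\<close>
  at most \<open>m j + 1\<close> functions are nonzero at the point, and the largest one exceeds every threshold,
  so at most \<open>m j\<close> colours are lost to the cover \<open>\<beta> j\<close>.  Hence at least one of the \<open>N\<close> colours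
  remains, and the groups cover the space.
\<close>

lemma join_covers_order:
  fixes \<beta> :: "'i \<Rightarrow> 'a set set" and m :: "'i \<Rightarrow> nat"
  assumes T: "metrizable_space T" and J: "finite J"
    and cov: "\<And>j. j \<in> J \<Longrightarrow> finite_open_cover T (\<beta> j)"
    and ord: "\<And>j x. j \<in> J \<Longrightarrow> x \<in> topspace T \<Longrightarrow> card {U \<in> \<beta> j. x \<in> U} \<le> Suc (m j)"
  obtains \<gamma> where "finite_open_cover T \<gamma>"
    and "\<And>W j. W \<in> \<gamma> \<Longrightarrow> j \<in> J \<Longrightarrow> \<exists>B\<in>\<beta> j. W \<subseteq> B"
    and "\<And>x. x \<in> topspace T \<Longrightarrow> card {W \<in> \<gamma>. x \<in> W} \<le> Suc (\<Sum>j\<in>J. m j)"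
proof -
  have fin: "finite (\<beta> j)" if "j \<in> J" for j
    using cov[OF that] by (auto simp: finite_open_cover_def)
  have "\<forall>j\<in>J. \<exists>f. (\<forall>U\<in>\<beta> j. continuous_map T euclideanreal (f U) \<and>
      (\<forall>x\<in>topspace T. 0 < f U x \<longleftrightarrow> x \<in> U)) \<and>
      (\<forall>x\<in>topspace T. (\<Sum>U\<in>\<beta> j. f U x) = 1)"
  proof
    fix j assume "j \<in> J"
    then obtain f where "\<And>U. U \<in> \<beta> j \<Longrightarrow> continuous_map T euclideanreal (f U)"
        "\<And>U x. U \<in> \<beta> j \<Longrightarrow> x \<in> topspace T \<Longrightarrow> 0 \<le> f U x"
        "\<And>U x. U \<in> \<beta> j \<Longrightarrow> x \<in> topspace T \<Longrightarrow> 0 < f U x \<longleftrightarrow> x \<in> U"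
        "\<And>x. x \<in> topspace T \<Longrightarrow> (\<Sum>U\<in>\<beta> j. f U x) = 1"
      using metrizable_partition_of_unity[OF T cov] by blast
    then show "\<exists>f. (\<forall>U\<in>\<beta> j. continuous_map T euclideanreal (f U) \<and>
      (\<forall>x\<in>topspace T. 0 < f U x \<longleftrightarrow> x \<in> U)) \<and>
      (\<forall>x\<in>topspace T. (\<Sum>U\<in>\<beta> j. f U x) = 1)"
      by (intro exI[of _ f]) blast
  qed
  from bchoice[OF this] obtain f where pou: "\<forall>j\<in>J. (\<forall>U\<in>\<beta> j.
      continuous_map T euclideanreal (f j U) \<and>
      (\<forall>x\<in>topspace T. 0 < f j U x \<longleftrightarrow> x \<in> U)) \<and>
      (\<forall>x\<in>topspace T. (\<Sum>U\<in>\<beta> j. f j U x) = 1)" ..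
  have f: "\<And>j U. j \<in> J \<Longrightarrow> U \<in> \<beta> j \<Longrightarrow> continuous_map T euclideanreal (f j U)"
      "\<And>j U x. j \<in> J \<Longrightarrow> U \<in> \<beta> j \<Longrightarrow> x \<in> topspace T \<Longrightarrow> 0 < f j U x \<longleftrightarrow> x \<in> U"
      "\<And>j x. j \<in> J \<Longrightarrow> x \<in> topspace T \<Longrightarrow> (\<Sum>U\<in>\<beta> j. f j U x) = 1"
    using pou by blast+
  define N where "N = Suc (\<Sum>j\<in>J. m j)"
  define C where "C = (\<Sum>j\<in>J. card (\<beta> j))"
  define t :: "nat \<Rightarrow> real" where "t k = inverse (real (Suc (C + k)))" for k
  have t_pos: "0 < t k" for k by (simp add: t_def)
  have t_inj: "t k = t l \<longleftrightarrow> k = l" for k l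
    unfolding t_def inverse_eq_iff_eq of_nat_eq_iff by simp
  \<comment> \<open>The values of a partition of unity with at most \<open>C\<close> members sum to 1, so one of them is
    larger than \<open>1 / (C + 1)\<close>, the largest threshold.\<close>
  have large: "\<exists>U\<in>\<beta> j. \<forall>k. t k < f j U y" if j: "j \<in> J" and y: "y \<in> topspace T" for j y
  proof (rule ccontr)
    assume no: "\<not> ?thesis"
    have small: "f j U y \<le> t 0" if U: "U \<in> \<beta> j" for U
    proof -
      obtain k where "\<not> t k < f j U y" using no U by blast
      moreover have "t k \<le> t 0" unfolding t_def by (intro le_imp_inverse_le) auto
      ultimately show ?thesis by simp
    qed
    have "card (\<beta> j) \<le> C"
      unfolding C_def using j J by (intro member_le_sum) auto
    have "(\<Sum>U\<in>\<beta> j. f j U y) \<le> real (card (\<beta> j)) * t 0"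
      using small by (intro sum_bounded_above) auto
    also have "\<dots> \<le> real C * t 0"
      using \<open>card (\<beta> j) \<le> C\<close> t_pos[of 0] by (intro mult_right_mono) auto
    also have "\<dots> < 1" by (simp add: t_def field_simps)
    finally show False using f(3)[OF j y] by simp
  qed
  \<comment> \<open>A group \<open>W k S\<close> is given by its colour \<open>k\<close> and the set \<open>S\<close> of those functions, of all the
    partitions together, that exceed the threshold.\<close>
  define P where "P = Sigma J \<beta>"
  have P: "finite P" unfolding P_def using J fin by blast
  define g where "g p = f (fst p) (snd p)" for p
  define W where "W k S = {y \<in> topspace T. \<forall>p\<in>P. if p \<in> S then t k < g p y else g p y < t k}"
    for k S
  define \<gamma> where "\<gamma> = {W k S | k S. k < N \<and> S \<subseteq> P \<and> W k S \<noteq> {}}"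
  have g_cont: "continuous_map T euclideanreal (g p)" if "p \<in> P" for p
    using that f(1) by (auto simp: P_def g_def)
  have W_open: "openin T (W k S)" for k S
  proof -
    have "openin T {y \<in> topspace T. g p y \<in> (if p \<in> S then {t k<..} else {..<t k})}" if "p \<in> P" for p
      using g_cont[OF that] by (rule openin_continuous_map_preimage) auto
    then have "openin T ((\<Inter>p\<in>P. {y \<in> topspace T. g p y \<in> (if p \<in> S then {t k<..} else {..<t k})})
        \<inter> topspace T)"
      using P by (intro openin_INT) auto
    also have "((\<Inter>p\<in>P. {y \<in> topspace T. g p y \<in> (if p \<in> S then {t k<..} else {..<t k})})
        \<inter> topspace T) = W k S"
      by (auto simp: W_def split: if_splits)
    finally show ?thesis .
  qed
  have \<gamma>_fin: "finite \<gamma>"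
  proof (rule finite_subset)
    show "\<gamma> \<subseteq> (\<lambda>(k, S). W k S) ` ({..<N} \<times> Pow P)" by (auto simp: \<gamma>_def)
  qed (use P in auto)
  have \<gamma>_cov: "y \<in> \<Union>\<gamma>" if y: "y \<in> topspace T" for y
  proof -
    \<comment> \<open>The colours lost to the cover \<open>\<beta> j\<close> at the point \<open>y\<close>.\<close>
    define bad where "bad j = {k. \<exists>U\<in>\<beta> j. f j U y = t k}" for j
    have bad: "finite (bad j) \<and> card (bad j) \<le> m j" if j: "j \<in> J" for j
    proof -
      obtain U0 where U0: "U0 \<in> \<beta> j" "\<And>k. t k < f j U0 y" using large[OF j y] by blast
      define A where "A = {U \<in> \<beta> j. y \<in> U}"
      have "U0 \<in> A" using U0 f(2)[OF j U0(1) y] less_trans[OF t_pos U0(2)] by (auto simp: A_def)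
      have "finite A" using fin[OF j] by (simp add: A_def)
      have "t ` bad j \<subseteq> (\<lambda>U. f j U y) ` (A - {U0})"
      proof
        fix q assume "q \<in> t ` bad j"
        then obtain k U where q: "q = t k" "U \<in> \<beta> j" "f j U y = t k" by (auto simp: bad_def)
        moreover have "U \<noteq> U0" using q U0(2)[of k] by auto
        moreover have "y \<in> U" using f(2)[OF j q(2) y] q t_pos[of k] by simp
        ultimately show "q \<in> (\<lambda>U. f j U y) ` (A - {U0})" by (auto simp: A_def intro!: image_eqI[of _ _ U])
      qed
      then have "finite (t ` bad j)"
        using \<open>finite A\<close> by (meson finite_Diff finite_surj)
      moreover have "card (t ` bad j) \<le> card (A - {U0})"
        using \<open>finite A\<close> \<open>t ` bad j \<subseteq> _\<close> by (intro surj_card_le) auto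
      moreover have "inj_on t (bad j)" by (simp add: inj_on_def t_inj)
      moreover have "card A \<le> Suc (m j)" using ord[OF j y] by (simp add: A_def)
      ultimately show ?thesis
        using \<open>U0 \<in> A\<close> \<open>finite A\<close> by (simp add: card_image finite_image_iff)
    qed
    have "card (\<Union>j\<in>J. bad j) \<le> (\<Sum>j\<in>J. card (bad j))" by (rule card_UN_le[OF J])
    also have "\<dots> \<le> (\<Sum>j\<in>J. m j)" using bad by (intro sum_mono) blast
    also have "\<dots> < card {..<N}" by (simp add: N_def)
    finally have "\<not> {..<N} \<subseteq> (\<Union>j\<in>J. bad j)"
      using bad J by (meson card_mono finite_UN leD)
    then obtain k where k: "k < N" "\<And>j. j \<in> J \<Longrightarrow> k \<notin> bad j" by auto
    define S where "S = {p \<in> P. t k < g p y}"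
    have "g p y < t k" if "p \<in> P" "p \<notin> S" for p
      using that k(2)[of "fst p"] by (fastforce simp: S_def P_def g_def bad_def)
    then have "y \<in> W k S" using y by (auto simp: W_def S_def)
    moreover have "W k S \<in> \<gamma>" using k(1) \<open>y \<in> W k S\<close> by (auto simp: \<gamma>_def S_def)
    ultimately show ?thesis by blast
  qed
  have \<gamma>_open: "openin T V" if "V \<in> \<gamma>" for V
    using that W_open by (auto simp: \<gamma>_def)
  have \<gamma>: "finite_open_cover T \<gamma>"
    unfolding finite_open_cover_def
    using \<gamma>_fin \<gamma>_open \<gamma>_cov openin_subset[OF \<gamma>_open] by blast
  have ref: "\<exists>B\<in>\<beta> j. V \<subseteq> B" if "V \<in> \<gamma>" and j: "j \<in> J" for V j
  proof -
    obtain k S y where V: "V = W k S" and y: "y \<in> W k S" using \<open>V \<in> \<gamma>\<close> by (auto simp: \<gamma>_def)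
    then have yT: "y \<in> topspace T" by (simp add: W_def)
    \<comment> \<open>A function that is large at one point of the group exceeds the threshold on all of it, hence
      the group lies in the set where this function is positive.\<close>
    obtain B where B: "B \<in> \<beta> j" "t k < f j B y" using large[OF j yT] by blast
    have jB: "(j, B) \<in> P" using j B by (simp add: P_def)
    with y B have "(j, B) \<in> S" by (force simp: W_def g_def split: if_splits)
    have "V \<subseteq> B"
    proof
      fix z assume "z \<in> V"
      then have "z \<in> topspace T" "t k < f j B z"
        using jB \<open>(j, B) \<in> S\<close> by (force simp: V W_def g_def)+
      then show "z \<in> B" using f(2)[OF j B(1)] less_trans[OF t_pos] by blast
    qed
    with B show ?thesis by blast
  qed
  have "card {V \<in> \<gamma>. y \<in> V} \<le> N" if "y \<in> topspace T" for y
  proof -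
    have "{V \<in> \<gamma>. y \<in> V} \<subseteq> (\<lambda>k. W k {p \<in> P. t k < g p y}) ` {..<N}"
    proof
      fix V assume "V \<in> {V \<in> \<gamma>. y \<in> V}"
      then obtain k S where V: "V = W k S" "k < N" "S \<subseteq> P" "y \<in> W k S" by (auto simp: \<gamma>_def)
      then have "S = {p \<in> P. t k < g p y}" by (auto simp: W_def dest: less_asym split: if_splits)
      with V show "V \<in> (\<lambda>k. W k {p \<in> P. t k < g p y}) ` {..<N}" by blast
    qed
    then show ?thesis using surj_card_le[of "{..<N}"] by auto
  qed
  then show ?thesis using that \<gamma> ref by (auto simp: N_def)
qed

section \<open>Orders of covers\<close>

lemma sum_indicator_eq_card_members:
  "finite \<beta> \<Longrightarrow> (\<Sum>U\<in>\<beta>. indicator U x) = real (card {U \<in> \<beta>. x \<in> U})"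
  by (simp add: indicator_def sum.If_cases Int_def)

text \<open>
  Only finitely many values occur, so the \<open>Max\<close> in \<^const>\<open>cover_ord\<close> is a genuine maximum.
\<close>

lemma finite_multiplicities:
  "finite \<beta> \<Longrightarrow> finite ((\<lambda>x. \<Sum>U\<in>\<beta>. indicator U x :: real) ` K)"
proof -
  assume "finite \<beta>"
  then have "(\<lambda>x. \<Sum>U\<in>\<beta>. indicator U x :: real) ` K \<subseteq> real ` {..card \<beta>}"
    by (auto simp: sum_indicator_eq_card_members intro!: card_mono)
  then show ?thesis using finite_subset by blast
qed

lemma cover_ord_le:
  assumes "finite \<beta>" and "\<And>x. x \<in> K \<Longrightarrow> card {U \<in> \<beta>. x \<in> U} \<le> Suc k"
  shows "cover_ord K \<beta> \<le> ereal (real k)"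
proof (cases "K = {}")
  case False
  have "Max ((\<lambda>x. \<Sum>U\<in>\<beta>. indicator U x :: real) ` K) \<le> real (Suc k)"
  proof (rule Max.boundedI[OF finite_multiplicities[OF assms(1)]])
    fix a assume "a \<in> (\<lambda>x. \<Sum>U\<in>\<beta>. indicator U x :: real) ` K"
    then obtain x where "x \<in> K" "a = real (card {U \<in> \<beta>. x \<in> U})"
      using assms(1) by (auto simp: sum_indicator_eq_card_members)
    then show "a \<le> real (Suc k)" using assms(2) by (simp del: of_nat_Suc)
  qed (use False in simp)
  with False show ?thesis by (simp add: cover_ord_def)
qed (simp add: cover_ord_def)

lemma cover_ord_eq_nat:
  assumes fin: "finite \<beta>" and ne: "K \<noteq> {}" and cov: "K \<subseteq> \<Union>\<beta>"
  obtains k :: nat where "cover_ord K \<beta> = ereal (real k)"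
    and "\<And>x. x \<in> K \<Longrightarrow> card {U \<in> \<beta>. x \<in> U} \<le> Suc k"
proof -
  define A where "A = (\<lambda>x. \<Sum>U\<in>\<beta>. indicator U x :: real) ` K"
  have A: "finite A" "A \<noteq> {}"
    using finite_multiplicities[OF fin] ne by (auto simp: A_def)
  then have "Max A \<in> A" by simp
  then obtain x where x: "x \<in> K" "Max A = real (card {U \<in> \<beta>. x \<in> U})"
    using fin by (auto simp: A_def sum_indicator_eq_card_members)
  have "{U \<in> \<beta>. x \<in> U} \<noteq> {}" using x cov by auto
  then have "card {U \<in> \<beta>. x \<in> U} \<noteq> 0" using fin by simp
  then obtain k where k: "card {U \<in> \<beta>. x \<in> U} = Suc k" by (cases "card {U \<in> \<beta>. x \<in> U}") auto
  show ?thesis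
  proof
    show "cover_ord K \<beta> = ereal (real k)"
      using ne x k by (simp add: cover_ord_def flip: A_def)
    fix z assume "z \<in> K"
    then have "real (card {U \<in> \<beta>. z \<in> U}) \<in> A"
      using fin by (auto simp: A_def sum_indicator_eq_card_members)
    then have "real (card {U \<in> \<beta>. z \<in> U}) \<le> Max A" using A by simp
    then show "card {U \<in> \<beta>. z \<in> U} \<le> Suc k" using x k by (simp del: of_nat_Suc)
  qed
qed

section \<open>Covers that refine along the fibres\<close>

definition fibrewise_refining ::
    "'a topology \<Rightarrow> nat \<Rightarrow> ('a \<Rightarrow> 'b) \<Rightarrow> 'a set set \<Rightarrow> (nat \<Rightarrow> 'a) set \<Rightarrow> (nat \<Rightarrow> 'a) set set \<Rightarrow> bool"
  where "fibrewise_refining X d \<pi> \<alpha> M \<beta> \<longleftrightarrow>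
    finite_open_cover (subtopology (product_topology (\<lambda>_. X) {1..d}) M) \<beta> \<and>
    refines_family (join_family (fibre_family (power_map d \<pi>) M) \<beta>)
                   (restrict_family (power_cover d \<alpha>) M)"

lemma D_cond_eq:
  "D_cond X \<phi> \<alpha> \<pi> \<rho> F \<delta> d \<tau> =
     (INF \<beta> \<in> Collect (fibrewise_refining X d \<pi> \<alpha> (sofic_Map X \<phi> \<rho> F \<delta> d \<tau>)).
        cover_ord (sofic_Map X \<phi> \<rho> F \<delta> d \<tau>) \<beta>)"
  unfolding D_cond_def fibrewise_refining_def[abs_def] Let_def ..

lemma sofic_Map_subset: "sofic_Map X \<phi> \<rho> F \<delta> d \<tau> \<subseteq> {1..d} \<rightarrow>\<^sub>E topspace X"
  by (auto simp: sofic_Map_def)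

lemma sofic_Map_mono:
  assumes "F' \<subseteq> F" and "\<delta> \<le> \<delta>'"
  shows "sofic_Map X \<phi> \<rho> F \<delta> d \<tau> \<subseteq> sofic_Map X \<phi> \<rho> F' \<delta>' d \<tau>"
  using assms unfolding sofic_Map_def by fastforce

lemma D_cond_empty_Map:
  assumes "sofic_Map X \<phi> \<rho> F \<delta> d \<tau> = {}"
  shows "D_cond X \<phi> \<alpha> \<pi> \<rho> F \<delta> d \<tau> = -\<infinity>"
proof -
  have "fibrewise_refining X d \<pi> \<alpha> {} {}"
    by (auto simp: fibrewise_refining_def finite_open_cover_def refines_family_def join_family_def)
  then have "D_cond X \<phi> \<alpha> \<pi> \<rho> F \<delta> d \<tau> \<le> cover_ord {} ({} :: (nat \<Rightarrow> 'a) set set)"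
    unfolding D_cond_eq assms by (intro INF_lower) simp
  then show ?thesis by (simp add: cover_ord_def)
qed

text \<open>
  A larger set \<open>F\<close> or a smaller \<open>\<delta>\<close> shrinks \<open>Map\<close>; restricting covers to the smaller set is what
  makes \<open>D\<close> monotone in these parameters.
\<close>

lemma fibrewise_refining_restrict:
  assumes fr: "fibrewise_refining X d \<pi> \<alpha> M \<beta>" and sub: "N \<subseteq> M"
  shows "fibrewise_refining X d \<pi> \<alpha> N (restrict_family \<beta> N)"
proof -
  let ?T = "product_topology (\<lambda>_. X) {1..d}"
  have cov: "finite_open_cover (subtopology ?T M) \<beta>"
    using fr by (simp add: fibrewise_refining_def)
  have "subtopology ?T N = subtopology (subtopology ?T M) N"
    using sub by (simp add: subtopology_subtopology Int_absorb1)
  moreover have "restrict_family \<beta> N = (\<lambda>U. U \<inter> N) ` \<beta>"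
    by (auto simp: restrict_family_def)
  ultimately have "finite_open_cover (subtopology ?T N) (restrict_family \<beta> N)"
    using cov by (fastforce simp: finite_open_cover_def intro: openin_subtopology_Int)
  moreover have "refines_family (join_family (fibre_family (power_map d \<pi>) N) (restrict_family \<beta> N))
      (restrict_family (power_cover d \<alpha>) N)"
    unfolding refines_family_def
  proof
    fix A assume "A \<in> join_family (fibre_family (power_map d \<pi>) N) (restrict_family \<beta> N)"
    then obtain \<eta> B where \<eta>: "\<eta> \<in> N" and B: "B \<in> \<beta>"
      and A: "A = {\<xi> \<in> N. power_map d \<pi> \<xi> = power_map d \<pi> \<eta>} \<inter> (B \<inter> N)"
      by (auto simp: join_family_def fibre_family_def restrict_family_def)
    let ?A = "{\<xi> \<in> M. power_map d \<pi> \<xi> = power_map d \<pi> \<eta>} \<inter> B"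
    have "?A \<in> join_family (fibre_family (power_map d \<pi>) M) \<beta>"
      unfolding join_family_def fibre_family_def using \<eta> B sub by blast
    then obtain P where "P \<in> power_cover d \<alpha>" "?A \<subseteq> P \<inter> M"
      using fr unfolding fibrewise_refining_def refines_family_def restrict_family_def by blast
    moreover from this have "A \<subseteq> P \<inter> N" using A sub by blast
    ultimately show "\<exists>B\<in>restrict_family (power_cover d \<alpha>) N. A \<subseteq> B"
      unfolding restrict_family_def by blast
  qed
  ultimately show ?thesis by (simp add: fibrewise_refining_def)
qed

lemma cover_ord_restrict:
  assumes fin: "finite \<beta>" and sub: "N \<subseteq> M" and cov: "M \<subseteq> \<Union>\<beta>"
  shows "cover_ord N (restrict_family \<beta> N) \<le> cover_ord M \<beta>"
proof (cases "N = {}")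
  case False
  with sub have "M \<noteq> {}" by auto
  then obtain k where k: "cover_ord M \<beta> = ereal (real k)"
      "\<And>x. x \<in> M \<Longrightarrow> card {U \<in> \<beta>. x \<in> U} \<le> Suc k"
    using cover_ord_eq_nat[OF fin _ cov] by metis
  have eq: "restrict_family \<beta> N = (\<lambda>U. U \<inter> N) ` \<beta>"
    by (auto simp: restrict_family_def)
  have "card {V \<in> restrict_family \<beta> N. x \<in> V} \<le> Suc k" if "x \<in> N" for x
  proof -
    have "{V \<in> restrict_family \<beta> N. x \<in> V} \<subseteq> (\<lambda>U. U \<inter> N) ` {U \<in> \<beta>. x \<in> U}"
      by (auto simp: eq)
    then have "card {V \<in> restrict_family \<beta> N. x \<in> V} \<le> card {U \<in> \<beta>. x \<in> U}"
      using fin by (intro surj_card_le) auto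
    also have "\<dots> \<le> Suc k" using k(2) sub that by blast
    finally show ?thesis .
  qed
  then show ?thesis unfolding k(1) using fin by (intro cover_ord_le) (auto simp: eq)
qed (simp add: cover_ord_def)

lemma D_cond_mono:
  assumes "F' \<subseteq> F" and "\<delta> \<le> \<delta>'"
  shows "D_cond X \<phi> \<alpha> \<pi> \<rho> F \<delta> d \<tau> \<le> D_cond X \<phi> \<alpha> \<pi> \<rho> F' \<delta>' d \<tau>"
proof -
  note sub = sofic_Map_mono[OF assms, of X \<phi> \<rho> d \<tau>]
  have "\<exists>\<gamma>\<in>Collect (fibrewise_refining X d \<pi> \<alpha> (sofic_Map X \<phi> \<rho> F \<delta> d \<tau>)).
      cover_ord (sofic_Map X \<phi> \<rho> F \<delta> d \<tau>) \<gamma> \<le> cover_ord (sofic_Map X \<phi> \<rho> F' \<delta>' d \<tau>) \<beta>"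
    if \<beta>: "fibrewise_refining X d \<pi> \<alpha> (sofic_Map X \<phi> \<rho> F' \<delta>' d \<tau>) \<beta>" for \<beta>
  proof
    have "finite \<beta>" "sofic_Map X \<phi> \<rho> F' \<delta>' d \<tau> \<subseteq> \<Union>\<beta>"
      using \<beta> sofic_Map_subset[of X \<phi> \<rho> F' \<delta>' d \<tau>]
      by (auto simp: fibrewise_refining_def finite_open_cover_def)
    then show "cover_ord (sofic_Map X \<phi> \<rho> F \<delta> d \<tau>) (restrict_family \<beta> (sofic_Map X \<phi> \<rho> F \<delta> d \<tau>))
        \<le> cover_ord (sofic_Map X \<phi> \<rho> F' \<delta>' d \<tau>) \<beta>"
      using sub by (intro cover_ord_restrict)
  qed (use fibrewise_refining_restrict[OF \<beta> sub] in simp)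
  then show ?thesis unfolding D_cond_eq by (intro INF_mono) auto
qed

text \<open>
  The members of the join of the \<open>\<beta> j\<close> are indexed by choice functions \<open>V\<close>, and the
  ambient set \<open>S\<close> provides the empty intersection when \<open>J\<close> is empty.
\<close>

definition jointly_refine :: "'a set \<Rightarrow> 'i set \<Rightarrow> ('i \<Rightarrow> 'a set set) \<Rightarrow> 'a set set \<Rightarrow> bool" where
  "jointly_refine S J \<beta> \<alpha> \<longleftrightarrow> (\<forall>V\<in>Pi J \<beta>. \<exists>U\<in>\<alpha>. S \<inter> (\<Inter>j\<in>J. V j) \<subseteq> U)"

text \<open>
  Within one fibre, a member \<open>W\<close> of \<open>\<gamma>\<close> is contained for each \<open>j\<close> in a box with sides in \<open>\<alpha>' j\<close>.
  The intersection of these boxes is again a box; its sides are members of the join of the \<open>\<alpha>' j\<close>,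
  so they fit into members of \<open>\<alpha>\<close>.
\<close>

lemma fibrewise_refining_join:
  assumes M: "M \<subseteq> {1..d} \<rightarrow>\<^sub>E topspace X"
    and ref: "jointly_refine (topspace X) J \<alpha>' \<alpha>"
    and \<beta>: "\<And>j. j \<in> J \<Longrightarrow> fibrewise_refining X d \<pi> (\<alpha>' j) M (\<beta> j)"
    and \<gamma>: "finite_open_cover (subtopology (product_topology (\<lambda>_. X) {1..d}) M) \<gamma>"
    and \<gamma>\<beta>: "\<And>W j. W \<in> \<gamma> \<Longrightarrow> j \<in> J \<Longrightarrow> \<exists>B\<in>\<beta> j. W \<subseteq> B"
  shows "fibrewise_refining X d \<pi> \<alpha> M \<gamma>"
proof -
  have "\<exists>B\<in>restrict_family (power_cover d \<alpha>) M. A \<subseteq> B"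
    if A: "A \<in> join_family (fibre_family (power_map d \<pi>) M) \<gamma>" for A
  proof -
    from A obtain P W where P: "P \<in> fibre_family (power_map d \<pi>) M" and W: "W \<in> \<gamma>" and A: "A = P \<inter> W"
      by (auto simp: join_family_def)
    have PM: "P \<subseteq> M" using P by (auto simp: fibre_family_def)
    have "\<forall>j\<in>J. \<exists>U. U \<in> {1..d} \<rightarrow> \<alpha>' j \<and> A \<subseteq> Pi\<^sub>E {1..d} U"
    proof
      fix j assume j: "j \<in> J"
      then obtain B where B: "B \<in> \<beta> j" "W \<subseteq> B" using \<gamma>\<beta>[OF W] by blast
      then have "P \<inter> B \<in> join_family (fibre_family (power_map d \<pi>) M) (\<beta> j)"
        using P by (auto simp: join_family_def)
      then obtain Q where "Q \<in> power_cover d (\<alpha>' j)" "P \<inter> B \<subseteq> Q \<inter> M"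
        using \<beta>[OF j] unfolding fibrewise_refining_def refines_family_def restrict_family_def
        by blast
      then show "\<exists>U. U \<in> {1..d} \<rightarrow> \<alpha>' j \<and> A \<subseteq> Pi\<^sub>E {1..d} U"
        using A B unfolding power_cover_def by blast
    qed
    from bchoice[OF this] obtain U where
      U: "\<forall>j\<in>J. U j \<in> {1..d} \<rightarrow> \<alpha>' j \<and> A \<subseteq> Pi\<^sub>E {1..d} (U j)" ..
    have "\<forall>a\<in>{1..d}. \<exists>V\<in>\<alpha>. topspace X \<inter> (\<Inter>j\<in>J. U j a) \<subseteq> V"
    proof
      fix a assume "a \<in> {1..d}"
      then have "(\<lambda>j. U j a) \<in> Pi J \<alpha>'" using U by (auto simp: Pi_iff)
      then show "\<exists>V\<in>\<alpha>. topspace X \<inter> (\<Inter>j\<in>J. U j a) \<subseteq> V"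
        using ref unfolding jointly_refine_def by blast
    qed
    from bchoice[OF this[unfolded Bex_def]] obtain V where
      V: "\<forall>a\<in>{1..d}. V a \<in> \<alpha> \<and> topspace X \<inter> (\<Inter>j\<in>J. U j a) \<subseteq> V a" ..
    have "A \<subseteq> Pi\<^sub>E {1..d} V"
    proof
      fix \<xi> assume \<xi>: "\<xi> \<in> A"
      then have \<xi>M: "\<xi> \<in> {1..d} \<rightarrow>\<^sub>E topspace X" using A PM M by blast
      have "\<xi> a \<in> V a" if a: "a \<in> {1..d}" for a
      proof -
        have "\<xi> a \<in> U j a" if "j \<in> J" for j
          using U that \<xi> a by blast
        moreover have "\<xi> a \<in> topspace X" using \<xi>M a by auto
        ultimately show ?thesis using V a by blast
      qed
      then show "\<xi> \<in> Pi\<^sub>E {1..d} V" using \<xi>M by (auto simp: PiE_iff)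
    qed
    with A PM have "A \<subseteq> Pi\<^sub>E {1..d} V \<inter> M" by blast
    moreover have "Pi\<^sub>E {1..d} V \<in> power_cover d \<alpha>"
      using V unfolding power_cover_def by blast
    then have "Pi\<^sub>E {1..d} V \<inter> M \<in> restrict_family (power_cover d \<alpha>) M"
      unfolding restrict_family_def by blast
    ultimately show ?thesis by (rule bexI)
  qed
  then show ?thesis using \<gamma> by (simp add: fibrewise_refining_def refines_family_def)
qed

section \<open>Subadditivity of mean dimension\<close>

text \<open>
  Over a nonempty \<open>Map\<close> all orders are natural numbers, so their infimum is attained: if every order
  exceeded \<open>c\<close>, the infimum would be at least \<open>\<lfloor>c\<rfloor> + 1 > c\<close>.
\<close>

lemma D_cond_attained:
  assumes "D_cond X \<phi> \<alpha> \<pi> \<rho> F \<delta> d \<tau> \<le> ereal c" and ne: "sofic_Map X \<phi> \<rho> F \<delta> d \<tau> \<noteq> {}"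
  obtains \<beta> k where "fibrewise_refining X d \<pi> \<alpha> (sofic_Map X \<phi> \<rho> F \<delta> d \<tau>) \<beta>" and "real k \<le> c"
    and "\<And>x. x \<in> sofic_Map X \<phi> \<rho> F \<delta> d \<tau> \<Longrightarrow> card {U \<in> \<beta>. x \<in> U} \<le> Suc k"
proof (rule ccontr)
  let ?M = "sofic_Map X \<phi> \<rho> F \<delta> d \<tau>"
  note attain = that
  assume no: "\<not> thesis"
  have "ereal (of_int (\<lfloor>c\<rfloor> + 1)) \<le> cover_ord ?M \<beta>" if \<beta>: "fibrewise_refining X d \<pi> \<alpha> ?M \<beta>" for \<beta>
  proof -
    have "finite \<beta>" "?M \<subseteq> \<Union>\<beta>"
      using \<beta> sofic_Map_subset[of X \<phi> \<rho> F \<delta> d \<tau>]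
      by (auto simp: fibrewise_refining_def finite_open_cover_def)
    then obtain k where k: "cover_ord ?M \<beta> = ereal (real k)"
        "\<And>x. x \<in> ?M \<Longrightarrow> card {U \<in> \<beta>. x \<in> U} \<le> Suc k"
      using cover_ord_eq_nat ne by metis
    then have "\<not> real k \<le> c" using no attain[OF \<beta>] by blast
    then have "\<lfloor>c\<rfloor> < int k" by (simp add: floor_less_iff)
    then have "of_int (\<lfloor>c\<rfloor> + 1) \<le> real k" by linarith
    then show ?thesis by (simp add: k(1))
  qed
  then have "ereal (of_int (\<lfloor>c\<rfloor> + 1)) \<le> D_cond X \<phi> \<alpha> \<pi> \<rho> F \<delta> d \<tau>"
    unfolding D_cond_eq by (intro INF_greatest) auto
  also have "\<dots> \<le> ereal c" by fact
  finally have "of_int (\<lfloor>c\<rfloor> + 1) \<le> c" by simp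
  then show False by linarith
qed

text \<open>
  Subadditivity of \<open>D\<close>, with a common bound \<open>c\<close> for the summands.  A bound by a real number in place
  of the sum itself avoids adding infinite values, which occur when \<open>Map\<close> is empty.
\<close>

lemma D_cond_join_le:
  assumes X: "metrizable_space X" and J: "finite J"
    and ref: "jointly_refine (topspace X) J \<alpha>' \<alpha>"
    and le: "\<And>j. j \<in> J \<Longrightarrow> D_cond X \<phi> (\<alpha>' j) \<pi> \<rho> F \<delta> d \<tau> \<le> ereal c"
  shows "D_cond X \<phi> \<alpha> \<pi> \<rho> F \<delta> d \<tau> \<le> ereal (real (card J) * c)"
proof (cases "sofic_Map X \<phi> \<rho> F \<delta> d \<tau> = {}")
  case True
  then show ?thesis by (simp add: D_cond_empty_Map)
next
  case False
  define M where "M = sofic_Map X \<phi> \<rho> F \<delta> d \<tau>"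
  define T where "T = subtopology (product_topology (\<lambda>_. X) {1..d}) M"
  have M_sub: "M \<subseteq> {1..d} \<rightarrow>\<^sub>E topspace X" unfolding M_def by (rule sofic_Map_subset)
  then have T_top: "topspace T = M" by (auto simp: T_def)
  have "metrizable_space (product_topology (\<lambda>_. X) {1..d})"
    using X by (auto simp: metrizable_space_product_topology)
  then have T_met: "metrizable_space T" unfolding T_def by (rule metrizable_space_subtopology)
  have "\<forall>j\<in>J. \<exists>p. fibrewise_refining X d \<pi> (\<alpha>' j) M (fst p) \<and> real (snd p) \<le> c \<and>
      (\<forall>x\<in>M. card {U \<in> fst p. x \<in> U} \<le> Suc (snd p))"
  proof
    fix j assume "j \<in> J"
    then obtain \<beta> k where "fibrewise_refining X d \<pi> (\<alpha>' j) M \<beta>" "real k \<le> c"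
        "\<And>x. x \<in> M \<Longrightarrow> card {U \<in> \<beta>. x \<in> U} \<le> Suc k"
      using D_cond_attained[OF le False] unfolding M_def by blast
    then show "\<exists>p. fibrewise_refining X d \<pi> (\<alpha>' j) M (fst p) \<and> real (snd p) \<le> c \<and>
        (\<forall>x\<in>M. card {U \<in> fst p. x \<in> U} \<le> Suc (snd p))"
      by (intro exI[of _ "(\<beta>, k)"]) simp
  qed
  from bchoice[OF this] obtain p where
    p: "\<forall>j\<in>J. fibrewise_refining X d \<pi> (\<alpha>' j) M (fst (p j)) \<and> real (snd (p j)) \<le> c \<and>
      (\<forall>x\<in>M. card {U \<in> fst (p j). x \<in> U} \<le> Suc (snd (p j)))" ..
  obtain \<gamma> where \<gamma>: "finite_open_cover T \<gamma>"
      "\<And>W j. W \<in> \<gamma> \<Longrightarrow> j \<in> J \<Longrightarrow> \<exists>B\<in>fst (p j). W \<subseteq> B"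
      "\<And>x. x \<in> topspace T \<Longrightarrow> card {W \<in> \<gamma>. x \<in> W} \<le> Suc (\<Sum>j\<in>J. snd (p j))"
  proof (rule join_covers_order[OF T_met J, of "\<lambda>j. fst (p j)" "\<lambda>j. snd (p j)"])
    show "finite_open_cover T (fst (p j))" if "j \<in> J" for j
      using p that by (simp add: fibrewise_refining_def T_def)
  qed (use p T_top in auto)
  have "fibrewise_refining X d \<pi> \<alpha> M \<gamma>"
    using M_sub ref _ \<gamma>(1)[unfolded T_def] \<gamma>(2)
    by (rule fibrewise_refining_join) (use p in auto)
  then have "D_cond X \<phi> \<alpha> \<pi> \<rho> F \<delta> d \<tau> \<le> cover_ord M \<gamma>"
    unfolding D_cond_eq M_def by (intro INF_lower) simp
  also have "\<dots> \<le> ereal (real (\<Sum>j\<in>J. snd (p j)))"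
    using \<gamma> T_top by (intro cover_ord_le) (auto simp: finite_open_cover_def)
  also have "\<dots> \<le> ereal (real (card J) * c)"
    using p sum_bounded_above[of J "\<lambda>j. real (snd (p j))" c] by simp
  finally show ?thesis .
qed

text \<open>
  For each \<open>j\<close> some \<open>F\<close> and \<open>\<delta>\<close> make \<open>D / d\<close> eventually smaller than \<open>e / (|J| + 1)\<close>.  By monotonicity
  the union of these finitely many \<open>F\<close> and the least of the \<open>\<delta>\<close> serve all \<open>j\<close> at once, and
  subadditivity of \<open>D\<close> applies for each \<open>i\<close>.
\<close>

lemma mdim_cover_join_nonpos:
  assumes G: "group G" and d: "\<And>i. d i > 0"
    and X: "metrizable_space X" and J: "finite J"
    and ref: "jointly_refine (topspace X) J \<alpha>' \<alpha>"
    and le: "\<And>j. j \<in> J \<Longrightarrow> mdim_cover G d \<sigma> X \<phi> \<rho> \<pi> (\<alpha>' j) \<le> 0"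
  shows "mdim_cover G d \<sigma> X \<phi> \<rho> \<pi> \<alpha> \<le> 0"
proof (rule ereal_le_epsilon2)
  fix e :: real assume e: "e > 0"
  define c where "c = e / real (Suc (card J))"
  have c: "c > 0" "real (card J) * c \<le> e" using e by (auto simp: c_def field_simps)
  have "\<forall>j\<in>J. \<exists>p. finite (fst p) \<and> fst p \<subseteq> carrier G \<and> snd p > 0 \<and>
      limsup (\<lambda>i. D_cond X \<phi> (\<alpha>' j) \<pi> \<rho> (fst p) (snd p) (d i) (\<sigma> i) / ereal (real (d i))) < ereal c"
  proof
    fix j assume "j \<in> J"
    then have "mdim_cover G d \<sigma> X \<phi> \<rho> \<pi> (\<alpha>' j) < ereal c"
      using le[of j] c by (metis ereal_less(2) order_le_less_trans)
    then obtain F \<delta> where "finite F" "F \<subseteq> carrier G" "\<delta> > 0"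
        "limsup (\<lambda>i. D_cond X \<phi> (\<alpha>' j) \<pi> \<rho> F \<delta> (d i) (\<sigma> i) / ereal (real (d i))) < ereal c"
      unfolding mdim_cover_def INF_less_iff by auto
    then show "\<exists>p. finite (fst p) \<and> fst p \<subseteq> carrier G \<and> snd p > 0 \<and>
      limsup (\<lambda>i. D_cond X \<phi> (\<alpha>' j) \<pi> \<rho> (fst p) (snd p) (d i) (\<sigma> i) / ereal (real (d i))) < ereal c"
      by (intro exI[of _ "(F, \<delta>)"]) simp
  qed
  from bchoice[OF this] obtain p where
    p: "\<forall>j\<in>J. finite (fst (p j)) \<and> fst (p j) \<subseteq> carrier G \<and> snd (p j) > 0 \<and>
      limsup (\<lambda>i. D_cond X \<phi> (\<alpha>' j) \<pi> \<rho> (fst (p j)) (snd (p j)) (d i) (\<sigma> i) / ereal (real (d i)))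
        < ereal c" ..
  \<comment> \<open>The unit and the value 1 keep \<open>F\<close> nonempty and \<open>\<delta>\<close> defined when \<open>J\<close> is empty.\<close>
  define F where "F = insert \<one>\<^bsub>G\<^esub> (\<Union>j\<in>J. fst (p j))"
  define \<delta> where "\<delta> = Min (insert 1 ((\<lambda>j. snd (p j)) ` J))"
  have F: "finite F" "F \<noteq> {}" "F \<subseteq> carrier G"
    using p J group.is_monoid[OF G] by (auto simp: F_def monoid.one_closed)
  have \<delta>: "\<delta> > 0" "\<And>j. j \<in> J \<Longrightarrow> \<delta> \<le> snd (p j)"
    using p J by (auto simp: \<delta>_def)
  have "\<forall>\<^sub>F i in sequentially. \<forall>j\<in>J.
      D_cond X \<phi> (\<alpha>' j) \<pi> \<rho> (fst (p j)) (snd (p j)) (d i) (\<sigma> i) / ereal (real (d i)) < ereal c"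
    using p J by (intro eventually_ball_finite) (auto intro: Limsup_lessD)
  then have "\<forall>\<^sub>F i in sequentially.
      D_cond X \<phi> \<alpha> \<pi> \<rho> F \<delta> (d i) (\<sigma> i) / ereal (real (d i)) \<le> ereal e"
  proof eventually_elim
    case (elim i)
    have di: "0 < ereal (real (d i))" "ereal (real (d i)) \<noteq> \<infinity>" using d[of i] by auto
    have "D_cond X \<phi> (\<alpha>' j) \<pi> \<rho> F \<delta> (d i) (\<sigma> i) \<le> ereal (real (d i) * c)" if j: "j \<in> J" for j
    proof -
      have "D_cond X \<phi> (\<alpha>' j) \<pi> \<rho> F \<delta> (d i) (\<sigma> i)
          \<le> D_cond X \<phi> (\<alpha>' j) \<pi> \<rho> (fst (p j)) (snd (p j)) (d i) (\<sigma> i)"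
        using j \<delta>(2)[OF j] by (intro D_cond_mono) (auto simp: F_def)
      also have "\<dots> \<le> ereal (real (d i)) * ereal c"
        using elim j di by (subst ereal_divide_le_pos[symmetric]) (auto intro: less_imp_le)
      finally show ?thesis by simp
    qed
    then have "D_cond X \<phi> \<alpha> \<pi> \<rho> F \<delta> (d i) (\<sigma> i) \<le> ereal (real (card J) * (real (d i) * c))"
      by (rule D_cond_join_le[OF X J ref])
    also have "\<dots> \<le> ereal (real (d i)) * ereal e"
      using mult_left_mono[OF c(2), of "real (d i)"] by (simp add: mult_ac)
    finally show ?case
      using di by (subst ereal_divide_le_pos) auto
  qed
  then have "limsup (\<lambda>i. D_cond X \<phi> \<alpha> \<pi> \<rho> F \<delta> (d i) (\<sigma> i) / ereal (real (d i))) \<le> ereal e"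
    by (rule Limsup_bounded)
  moreover have "mdim_cover G d \<sigma> X \<phi> \<rho> \<pi> \<alpha>
      \<le> limsup (\<lambda>i. D_cond X \<phi> \<alpha> \<pi> \<rho> F \<delta> (d i) (\<sigma> i) / ereal (real (d i)))"
    unfolding mdim_cover_def using F \<delta>(1) by (intro INF_lower2[of F] INF_lower2[of \<delta>]) auto
  ultimately show "mdim_cover G d \<sigma> X \<phi> \<rho> \<pi> \<alpha> \<le> 0 + ereal e" by simp
qed

lemma mdim_cover_empty_space:
  assumes "group G" and d: "\<And>i. d i > 0" and "topspace X = {}"
  shows "mdim_cover G d \<sigma> X \<phi> \<rho> \<pi> \<alpha> \<le> 0"
proof -
  have "sofic_Map X \<phi> \<rho> {\<one>\<^bsub>G\<^esub>} 1 (d i) (\<sigma> i) = {}" for i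
  proof -
    have "1 \<in> {1..d i}" using d[of i] by simp
    then have "({1..d i} \<rightarrow>\<^sub>E topspace X) = {}" unfolding PiE_eq_empty_iff using assms(3) by blast
    then show ?thesis using sofic_Map_subset by blast
  qed
  then have "D_cond X \<phi> \<alpha> \<pi> \<rho> {\<one>\<^bsub>G\<^esub>} 1 (d i) (\<sigma> i) / ereal (real (d i)) \<le> 0" for i
    using d[of i] by (simp add: D_cond_empty_Map)
  then have "limsup (\<lambda>i. D_cond X \<phi> \<alpha> \<pi> \<rho> {\<one>\<^bsub>G\<^esub>} 1 (d i) (\<sigma> i) / ereal (real (d i))) \<le> 0"
    by (intro Limsup_bounded always_eventually) simp
  then show ?thesis
    unfolding mdim_cover_def using group.is_monoid[OF assms(1)]
    by (intro INF_lower2[of "{\<one>\<^bsub>G\<^esub>}"] INF_lower2[of 1]) (auto simp: monoid.one_closed)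
qed

section \<open>Locating a mean dimension tuple\<close>

text \<open>
  Admissibility of \<open>\<beta> x\<close> for \<open>x\<close> persists on a box: every member of \<open>\<beta> x\<close> misses, for some \<open>i\<close>,
  the neighbourhood \<open>N x i\<close> of \<open>x i\<close>.  Let \<open>J\<close> be the centres of finitely many boxes that cover the
  product of the complements.  Were an intersection of members \<open>V x \<in> \<beta> x\<close>, \<open>x \<in> J\<close>, contained in no
  \<open>e i\<close>, it would contain the entries of a tuple \<open>y\<close> in this product.  Now \<open>y\<close> lies in the box of
  some \<open>x \<in> J\<close>, so \<open>V x\<close> would meet every side of that box, which no member of \<open>\<beta> x\<close> does.
\<close>

lemma admissible_join_of_local_covers:
  assumes X: "compact_space X" and \<alpha>: "finite_open_cover X \<alpha>" and e: "e ` {1..n} = \<alpha>"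
    and adm: "\<And>x. x \<in> Pi\<^sub>E {1..n} (\<lambda>i. topspace X - e i) \<Longrightarrow> admissible_cover X n x (\<beta> x)"
  obtains J where "finite J" and "J \<subseteq> Pi\<^sub>E {1..n} (\<lambda>i. topspace X - e i)"
    and "jointly_refine (topspace X) J \<beta> \<alpha>"
proof -
  define K where "K = Pi\<^sub>E {1..n} (\<lambda>i. topspace X - e i)"
  define N where "N x i = topspace X - \<Union>{X closure_of V | V. V \<in> \<beta> x \<and> x i \<notin> X closure_of V}"
    for x i
  define B where "B x = Pi\<^sub>E {1..n} (N x)" for x
  have "compactin X (topspace X - e i)" if "i \<in> {1..n}" for i
  proof -
    have "openin X (e i)" using \<alpha> e that by (auto simp: finite_open_cover_def)
    then show ?thesis using X by (intro closedin_compact_space) auto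
  qed
  then have K_compact: "compactin (product_topology (\<lambda>_. X) {1..n}) K"
    by (simp add: K_def compactin_PiE)
  have B_open: "openin (product_topology (\<lambda>_. X) {1..n}) (B x)" if "x \<in> K" for x
  proof -
    have "finite (\<beta> x)"
      using adm that by (auto simp: K_def admissible_cover_def finite_open_cover_def)
    then have "openin X (N x i)" for i
      unfolding N_def by (intro openin_diff openin_topspace closedin_Union) auto
    then show ?thesis by (simp add: B_def openin_PiE)
  qed
  have "K \<subseteq> \<Union>(B ` K)"
  proof
    fix x assume "x \<in> K"
    then have "x \<in> B x" by (auto simp: B_def N_def K_def PiE_iff)
    with \<open>x \<in> K\<close> show "x \<in> \<Union>(B ` K)" by blast
  qed
  then obtain \<F> where \<F>: "finite \<F>" "\<F> \<subseteq> B ` K" "K \<subseteq> \<Union>\<F>"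
    using compactinD[OF K_compact, of "B ` K"] B_open by blast
  obtain J where "J \<subseteq> K" "finite J" "\<F> = B ` J"
    using finite_subset_image[OF \<F>(1,2)] by blast
  with \<F> have J: "finite J" "J \<subseteq> K" "K \<subseteq> \<Union>(B ` J)" by auto
  have "jointly_refine (topspace X) J \<beta> \<alpha>"
    unfolding jointly_refine_def
  proof (rule ballI, rule ccontr)
    fix V assume V: "V \<in> Pi J \<beta>" and no: "\<not> (\<exists>U\<in>\<alpha>. topspace X \<inter> (\<Inter>j\<in>J. V j) \<subseteq> U)"
    have "\<forall>i\<in>{1..n}. \<exists>y. y \<in> topspace X \<inter> (\<Inter>j\<in>J. V j) \<and> y \<notin> e i"
      using no e by blast
    from bchoice[OF this] obtain y where
      y: "\<forall>i\<in>{1..n}. y i \<in> topspace X \<inter> (\<Inter>j\<in>J. V j) \<and> y i \<notin> e i" ..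
    then have "restrict y {1..n} \<in> K" by (auto simp: K_def)
    then obtain x where x: "x \<in> J" "restrict y {1..n} \<in> B x" using J(3) by blast
    then have Vx: "V x \<in> \<beta> x" using V by blast
    have "admissible_cover X n x (\<beta> x)" using adm x J by (auto simp: K_def)
    then obtain i where i: "i \<in> {1..n}" "x i \<notin> X closure_of V x"
      using Vx unfolding admissible_cover_def by blast
    have "y i \<in> N x i" using x(2) i(1) by (auto simp: B_def PiE_iff)
    moreover have "y i \<in> X closure_of V x"
      using y i(1) x(1) closure_of_subset_Int[of X "V x"] by blast
    ultimately show False using i(2) Vx by (auto simp: N_def)
  qed
  with J that show ?thesis by (simp add: K_def)
qed

text \<open>
  With \<open>P\<close>, \<open>Q\<close> disjoint neighbourhoods of \<open>p\<close>, \<open>q\<close>, and \<open>B\<close> an open set containing \<open>X - P\<close> that is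
  disjoint from a neighbourhood of \<open>p\<close>, the sets \<open>P\<close> and \<open>B\<close> cover \<open>X\<close>, while \<open>q\<close> is not in the closure
  of \<open>P\<close> and \<open>p\<close> is not in that of \<open>B\<close>.
\<close>

lemma separating_admissible_cover:
  assumes H: "Hausdorff_space X" and R: "regular_space X"
    and pq: "p \<in> x ` {1..n}" "q \<in> x ` {1..n}" "p \<in> topspace X" "q \<in> topspace X" "p \<noteq> q"
  obtains \<alpha> where "admissible_cover X n x \<alpha>"
proof -
  obtain P Q where PQ: "openin X P" "openin X Q" "p \<in> P" "q \<in> Q" "disjnt P Q"
    using H pq unfolding Hausdorff_space_def by blast
  have "closedin X (topspace X - P)" "p \<in> topspace X - (topspace X - P)"
    using PQ pq by auto
  then obtain A B where AB: "openin X A" "openin X B" "p \<in> A" "topspace X - P \<subseteq> B" "disjnt A B"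
    using R[unfolded regular_space_def, rule_format, of "topspace X - P" p] by blast
  have "q \<notin> X closure_of P"
    using PQ openin_Int_closure_of_eq_empty[OF PQ(2), of P] by (auto simp: disjnt_def)
  moreover have "p \<notin> X closure_of B"
    using AB openin_Int_closure_of_eq_empty[OF AB(1), of B] by (auto simp: disjnt_def)
  moreover have "finite_open_cover X {P, B}"
    using PQ AB openin_subset[OF PQ(1)] openin_subset[OF AB(2)] by (auto simp: finite_open_cover_def)
  ultimately have "admissible_cover X n x {P, B}"
    using pq by (auto simp: admissible_cover_def)
  then show ?thesis by (rule that)
qed

theorem theorem4p7:
  fixes G :: "('g, 'm) monoid_scheme"
    and d :: "nat \<Rightarrow> nat" and \<sigma> :: "nat \<Rightarrow> 'g \<Rightarrow> nat \<Rightarrow> nat"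
    and X :: "'a topology" and \<phi> :: "'g \<Rightarrow> 'a \<Rightarrow> 'a" and \<rho> :: "'a \<Rightarrow> 'a \<Rightarrow> real"
    and Y :: "'b topology" and \<psi> :: "'g \<Rightarrow> 'b \<Rightarrow> 'b" and \<pi> :: "'a \<Rightarrow> 'b"
  assumes "group G" and "countable (carrier G)" and "sofic_group G"
    and "sofic_approximation G d \<sigma>"
    and "G_system G X \<phi>" and "G_system G Y \<psi>"
    and "factor_map G X \<phi> Y \<psi> \<pi>"
    and "compatible_metric X \<rho>"
  shows "mdim G d \<sigma> X \<phi> \<rho> \<pi> > 0 \<longleftrightarrow>
         (\<exists>n\<ge>2. mdim_tuples n G d \<sigma> X \<phi> \<rho> \<pi> \<noteq> {})"
proof
  have d: "d i > 0" for i using assms(4) by (simp add: sofic_approximation_def)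
  have cX: "compact_space X" and mX: "metrizable_space X"
    using assms(5) by (auto simp: G_system_def)
  {
    assume "mdim G d \<sigma> X \<phi> \<rho> \<pi> > 0"
    then obtain \<alpha> where \<alpha>: "finite_open_cover X \<alpha>" and pos: "mdim_cover G d \<sigma> X \<phi> \<rho> \<pi> \<alpha> > 0"
      unfolding mdim_def less_SUP_iff by auto
    have "topspace X \<noteq> {}"
    proof
      assume "topspace X = {}"
      then have "mdim_cover G d \<sigma> X \<phi> \<rho> \<pi> \<alpha> \<le> 0"
        by (rule mdim_cover_empty_space[OF assms(1) d])
      with pos show False by simp
    qed
    then have "\<alpha> \<noteq> {}"
      using \<alpha> unfolding finite_open_cover_def by (metis Union_empty)
    have fin: "finite \<alpha>" using \<alpha> by (simp add: finite_open_cover_def)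
    \<comment> \<open>The last member of \<open>\<alpha>\<close> is listed twice, which makes the tuples at least pairs even if
      \<open>\<alpha>\<close> has a single member.\<close>
    define N where "N = card \<alpha>"
    obtain h where h: "bij_betw h {1..N} \<alpha>"
      using ex_bij_betw_nat_finite_1[OF fin] unfolding N_def by blast
    have N: "N \<ge> 1" using \<open>\<alpha> \<noteq> {}\<close> fin by (simp add: N_def Suc_le_eq card_gt_0_iff)
    define e where "e i = h (min i N)" for i
    define n where "n = Suc N"
    have n: "n \<ge> 2" using N by (simp add: n_def)
    have e: "e ` {1..n} = \<alpha>"
    proof -
      have "(\<lambda>i. min i N) ` {1..n} = {1..N}" using N by (force simp: n_def image_iff)
      moreover have "e ` {1..n} = h ` ((\<lambda>i. min i N) ` {1..n})"
        by (simp add: image_image e_def[abs_def])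
      ultimately show ?thesis using h by (simp add: bij_betw_def)
    qed
    show "\<exists>n\<ge>2. mdim_tuples n G d \<sigma> X \<phi> \<rho> \<pi> \<noteq> {}"
    proof (rule ccontr)
      assume "\<not> ?thesis"
      with n have none: "mdim_tuples n G d \<sigma> X \<phi> \<rho> \<pi> = {}" by blast
      have "\<exists>\<beta>. admissible_cover X n x \<beta> \<and> mdim_cover G d \<sigma> X \<phi> \<rho> \<pi> \<beta> \<le> 0"
        if x: "x \<in> Pi\<^sub>E {1..n} (\<lambda>i. topspace X - e i)" for x
      proof -
        have "x \<notin> diagonal n (topspace X)"
        proof
          assume "x \<in> diagonal n (topspace X)"
          then obtain a where a: "a \<in> topspace X" "x = (\<lambda>i\<in>{1..n}. a)"
            by (auto simp: diagonal_def)
          then have "a \<notin> e i" if "i \<in> {1..n}" for i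
            using PiE_mem[OF x that] that by simp
          then have "a \<notin> \<Union>\<alpha>" using e by blast
          with a \<alpha> show False by (simp add: finite_open_cover_def)
        qed
        moreover have "x \<in> {1..n} \<rightarrow>\<^sub>E topspace X" using x by (auto simp: PiE_iff)
        ultimately show ?thesis using none by (auto simp: mdim_tuples_def not_less)
      qed
      then obtain \<beta> where \<beta>: "\<And>x. x \<in> Pi\<^sub>E {1..n} (\<lambda>i. topspace X - e i) \<Longrightarrow>
          admissible_cover X n x (\<beta> x) \<and> mdim_cover G d \<sigma> X \<phi> \<rho> \<pi> (\<beta> x) \<le> 0"
        by metis
      obtain J where J: "finite J" "J \<subseteq> Pi\<^sub>E {1..n} (\<lambda>i. topspace X - e i)"
          "jointly_refine (topspace X) J \<beta> \<alpha>"
        using admissible_join_of_local_covers[OF cX \<alpha> e, of \<beta>] \<beta> by blast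
      have "mdim_cover G d \<sigma> X \<phi> \<rho> \<pi> \<alpha> \<le> 0"
        using J \<beta> by (intro mdim_cover_join_nonpos[OF assms(1) d mX J(1) J(3)]) blast
      with pos show False by simp
    qed
  }
  assume "\<exists>n\<ge>2. mdim_tuples n G d \<sigma> X \<phi> \<rho> \<pi> \<noteq> {}"
  then obtain n x where n: "n \<ge> 2" and x: "x \<in> mdim_tuples n G d \<sigma> X \<phi> \<rho> \<pi>" by blast
  then have xX: "x \<in> {1..n} \<rightarrow>\<^sub>E topspace X" and nd: "x \<notin> diagonal n (topspace X)"
    by (auto simp: mdim_tuples_def)
  have 1: "1 \<in> {1..n}" using n by simp
  have "\<exists>i\<in>{1..n}. x i \<noteq> x 1"
  proof (rule ccontr)
    assume const: "\<not> ?thesis"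
    have "x = (\<lambda>i\<in>{1..n}. x 1)"
    proof
      fix k show "x k = (\<lambda>i\<in>{1..n}. x 1) k"
      proof (cases "k \<in> {1..n}")
        case True
        with const have "x k = x 1" by blast
        with True show ?thesis by (simp only: restrict_apply if_True)
      next
        case False
        with PiE_arb[OF xX] show ?thesis by (simp only: restrict_apply if_False)
      qed
    qed
    with nd show False using PiE_mem[OF xX 1] unfolding diagonal_def by blast
  qed
  then obtain i where i: "i \<in> {1..n}" "x i \<noteq> x 1" by blast
  obtain \<alpha> where "admissible_cover X n x \<alpha>"
  proof (rule separating_admissible_cover)
    show "Hausdorff_space X" "regular_space X"
      using mX by (auto intro: metrizable_imp_Hausdorff_space metrizable_imp_regular_space)
    show "x i \<in> x ` {1..n}" "x 1 \<in> x ` {1..n}" "x i \<noteq> x 1" using i 1 by blast+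
    show "x i \<in> topspace X" "x 1 \<in> topspace X" using PiE_mem[OF xX] i 1 by blast+
  qed
  then have "finite_open_cover X \<alpha>" "mdim_cover G d \<sigma> X \<phi> \<rho> \<pi> \<alpha> > 0"
    using x by (auto simp: mdim_tuples_def admissible_cover_def)
  then show "mdim G d \<sigma> X \<phi> \<rho> \<pi> > 0"
    unfolding mdim_def less_SUP_iff by auto
qed

end
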